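(* Let $d\ge2$. Consider the exponential family corresponding to the single-component truncated multivariate normal distributions on $[0,\infty)\times\mathbb{R}^{d-1}$ (first component truncated to the left at zero, the remaining components untruncated), with densities $$\exp\big(\boldsymbol{\theta}'\boldsymbol{t}-\boldsymbol{t}'\boldsymbol{\Theta}\boldsymbol{t}-K_T(\boldsymbol{\theta},\boldsymbol{\Theta})\big),\quad \boldsymbol{t}\in[0,\infty)\times\mathbb{R}^{d-1},\qquad(\boldsymbol{\theta},\boldsymbol{\Theta})\in\mathcal{D},$$ and canonical parameter space $\mathcal{D}=\{(\boldsymbol{\theta},\boldsymbol{\Theta})\in\mathbb{R}^d\times\mathcal{S}^{d\times d}:L_T(\boldsymbol{\theta},\boldsymbol{\Theta})<\infty\}$. This exponential family is not steep.
   Context: Notation: a prime denotes transpose; $\mathcal{S}^{d\times d}$ is the space of real symmetric $d\times d$ matrices; with $\boldsymbol{t}=(t_1,\boldsymbol{t}_2')'$, $\boldsymbol{t}_2=(t_2,\ldots,t_d)'$, $$L_T(\boldsymbol{\theta},\boldsymbol{\Theta})=\int_0^\infty\int_{\mathbb{R}^{d-1}}\exp(\boldsymbol{\theta}'\boldsymbol{t}-\boldsymbol{t}'\boldsymbol{\Theta}\boldsymbol{t})\,d\boldsymbol{t}_2\,dt_1,\qquad K_T=\log L_T.$$ Steepness: Let $\Omega=\mathrm{Int}(\mathcal{D})$ (interior in $\mathbb{R}^d\times\mathcal{S}^{d\times d}$) and $\partial\Omega=\mathrm{cl}(\Omega)\cap\mathrm{cl}(\Omega^c)$. Write $\boldsymbol{\omega}=(\boldsymbol{\theta},\boldsymbol{\Theta})$.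 With $\nabla_{\boldsymbol{\theta}}=(\partial/\partial\theta_1,\ldots,\partial/\partial\theta_d)'$ and, for $\boldsymbol{\Theta}=(\Theta_{ij})$, $\nabla_{\boldsymbol{\Theta}}=\big(\tfrac12(1+\delta_{i,j})\,\partial/\partial\Theta_{ij}\big)_{i,j}$ (a symmetric matrix of operators), define $$\|\nabla_{\boldsymbol{\omega}}K_T(\boldsymbol{\theta},\boldsymbol{\Theta})\|=\big[\|\nabla_{\boldsymbol{\theta}}K_T(\boldsymbol{\theta},\boldsymbol{\Theta})\|^2+\|\nabla_{\boldsymbol{\Theta}}K_T(\boldsymbol{\theta},\boldsymbol{\Theta})\|_F^2\big]^{1/2},$$ where $\|\cdot\|$ is the Euclidean norm and $\|\cdot\|_F$ the Frobenius norm. The family is steep at $\boldsymbol{\omega}_0\in\partial\Omega$ if $\|\nabla_{\boldsymbol{\omega}}K_T(\boldsymbol{\omega})\|\to\infty$ as $\boldsymbol{\omega}\to\boldsymbol{\omega}_0$ (with $\boldsymbol{\omega}\in\Omega$); it is steep if it is steep at every point $\boldsymbol{\omega}_0\in\partial\Omega$. *)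

theory Defs
  imports "HOL-Analysis.Analysis"
begin

type_synonym 'd param = "(real ^ 'd) \<times> (real ^ 'd ^ 'd)"

definition sym_matrices :: "(real ^ 'd ^ 'd) set" where
  "sym_matrices = {A. transpose A = A}"

text \<open>The ambient space of all parameters, \<open>\<real>\<^sup>d\<close> times the symmetric matrices. Interior and boundary
  of a parameter set are taken relative to it, since the symmetric matrices have empty interior in
  the type of all square matrices.\<close>

definition param_topology :: "('d::finite) param topology" where
  "param_topology = top_of_set (UNIV \<times> sym_matrices)"

definition par_interior :: "('d::finite) param set \<Rightarrow> 'd param set" where
  "par_interior D = param_topology interior_of D"

definition par_boundary :: "('d::finite) param set \<Rightarrow> 'd param set" where
  "par_boundary W = param_topology closure_of W \<inter>
     param_topology closure_of (topspace param_topology - W)"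


subsection \<open>Gradient and steepness\<close>

text \<open>On symmetric matrices the entries \<open>(i, j)\<close> and \<open>(j, i)\<close> are one variable, so the partial
  derivative with respect to it is taken in the direction that changes both entries.\<close>

definition sym_unit :: "'d \<Rightarrow> 'd \<Rightarrow> real ^ 'd ^ 'd" where
  "sym_unit i j = (\<chi> a b. if (a = i \<and> b = j) \<or> (a = j \<and> b = i) then 1 else 0)"

definition partial_theta :: "('d::finite param \<Rightarrow> real) \<Rightarrow> 'd param \<Rightarrow> 'd \<Rightarrow> real" where
  "partial_theta K \<omega> i = deriv (\<lambda>h. K (fst \<omega> + h *\<^sub>R axis i 1, snd \<omega>)) 0"

definition partial_Theta :: "('d::finite param \<Rightarrow> real) \<Rightarrow> 'd param \<Rightarrow> 'd \<Rightarrow> 'd \<Rightarrow> real" where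
  "partial_Theta K \<omega> i j = deriv (\<lambda>h. K (fst \<omega>, snd \<omega> + h *\<^sub>R sym_unit i j)) 0"

text \<open>The library norm of this pair is the norm of the gradient: the norm of a pair is the root of
  the sum of the squared norms, and the norm of the type \<open>real ^ 'd ^ 'd\<close> is the Frobenius norm.\<close>

definition grad :: "('d::finite param \<Rightarrow> real) \<Rightarrow> 'd param \<Rightarrow> 'd param" where
  "grad K \<omega> =
     ((\<chi> i. partial_theta K \<omega> i),
      (\<chi> i j. 1/2 * (1 + (if i = j then 1 else 0)) * partial_Theta K \<omega> i j))"

definition steep_at :: "('d::finite) param set \<Rightarrow> ('d param \<Rightarrow> real) \<Rightarrow> 'd param \<Rightarrow> bool" where
  "steep_at D K \<omega>\<^sub>0 \<longleftrightarrow>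
     filterlim (\<lambda>\<omega>. norm (grad K \<omega>)) at_top (at \<omega>\<^sub>0 within par_interior D)"

text \<open>Steepness of the exponential family with canonical parameter space \<open>D\<close> and cumulant function
  \<open>K\<close>.\<close>

definition steep :: "('d::finite) param set \<Rightarrow> ('d param \<Rightarrow> real) \<Rightarrow> bool" where
  "steep D K \<longleftrightarrow> (\<forall>\<omega>\<^sub>0 \<in> par_boundary (par_interior D). steep_at D K \<omega>\<^sub>0)"


subsection \<open>Normal distributions truncated in a single component\<close>

text \<open>The index \<open>k\<close> marks the truncated (``first'') component; the index type carries no order.
  The iterated integral over \<open>[0, \<infinity>)\<close> and \<open>\<real>\<^sup>d\<^sup>-\<^sup>1\<close> is the Lebesgue integral of a nonnegative function
  over the half-space, with value in the extended nonnegative reals.\<close>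

definition half_space :: "'d \<Rightarrow> (real ^ 'd) set" where
  "half_space k = {t. 0 \<le> t $ k}"

definition L_T :: "'d::finite \<Rightarrow> 'd param \<Rightarrow> ennreal" where
  "L_T k = (\<lambda>(\<theta>, \<Theta>).
     \<integral>\<^sup>+ t \<in> half_space k. ennreal (exp (\<theta> \<bullet> t - t \<bullet> (\<Theta> *v t))) \<partial>lborel)"

definition canonical_space :: "'d::finite \<Rightarrow> 'd param set" where
  "canonical_space k = {\<omega> \<in> UNIV \<times> sym_matrices. L_T k \<omega> < \<infinity>}"

text \<open>Only used on \<open>canonical_space k\<close>, where \<open>L_T k\<close> is finite.\<close>

definition K_T :: "'d::finite \<Rightarrow> 'd param \<Rightarrow> real" where
  "K_T k \<omega> = ln (enn2real (L_T k \<omega>))"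

definition tmvn_density :: "'d::finite \<Rightarrow> 'd param \<Rightarrow> real ^ 'd \<Rightarrow> real" where
  "tmvn_density k = (\<lambda>(\<theta>, \<Theta>) t.
     indicator (half_space k) t * exp (\<theta> \<bullet> t - t \<bullet> (\<Theta> *v t) - K_T k (\<theta>, \<Theta>)))"

lemma half_space_measurable [measurable]: "half_space k \<in> sets borel"
  unfolding half_space_def by (simp add: borel_closed closed_halfspace_component_ge_cart)

lemma measurable_quadratic [measurable]:
  "(\<lambda>t. exp (\<theta> \<bullet> t - t \<bullet> (\<Theta> *v t))) \<in> borel_measurable (borel :: (real ^ 'd) measure)"
  by (intro borel_measurable_continuous_onI continuous_intros
      linear_continuous_on matrix_vector_mul_bounded_linear)

lemma L_T_pos: "0 < L_T k (\<theta>, \<Theta> :: real ^ 'd ^ 'd)"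
proof -
  have "\<not> (AE t in lborel. t \<notin> half_space k)"
  proof
    assume "AE t in lborel. t \<notin> half_space k"
    then have z: "emeasure lborel (half_space k) = 0"
      by (subst (asm) AE_iff_measurable[where N = "half_space k"]) auto
    have "box 0 One \<subseteq> half_space k"
      by (auto simp: half_space_def mem_box_cart less_imp_le)
    then have "emeasure lborel (box (0 :: real ^ 'd) One) \<le> emeasure lborel (half_space k)"
      by (intro emeasure_mono) auto
    with z show False
      by (simp add: emeasure_lborel_box_eq)
  qed
  then have "L_T k (\<theta>, \<Theta>) \<noteq> 0"
    unfolding L_T_def prod.case
    by (subst nn_integral_0_iff_AE) (auto simp: indicator_def)
  then show ?thesis
    by (simp add: zero_less_iff_neq_zero)
qed

text \<open>\<open>K_T\<close> is the log-normalizer: the functions \<open>tmvn_density k \<omega>\<close> are probability densities.\<close>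

lemma nn_integral_tmvn_density:
  assumes "\<omega> \<in> canonical_space k"
  shows "(\<integral>\<^sup>+ t. ennreal (tmvn_density k \<omega> t) \<partial>lborel) = 1"
proof -
  obtain \<theta> \<Theta> where \<omega>: "\<omega> = (\<theta>, \<Theta>)" by (cases \<omega>)
  define l where "l = enn2real (L_T k \<omega>)"
  have L: "L_T k \<omega> = ennreal l" and l: "l > 0"
    using assms L_T_pos[of k \<theta> \<Theta>]
    by (auto simp: l_def canonical_space_def \<omega> enn2real_positive_iff less_top)
  have "(\<integral>\<^sup>+ t. ennreal (tmvn_density k \<omega> t) \<partial>lborel) =
      (\<integral>\<^sup>+ t. ennreal (1 / l) *
        (ennreal (exp (\<theta> \<bullet> t - t \<bullet> (\<Theta> *v t))) * indicator (half_space k) t) \<partial>lborel)"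
    using l
    by (intro nn_integral_cong)
       (auto simp: tmvn_density_def \<omega> K_T_def l_def exp_diff indicator_def ennreal_mult[symmetric])
  also have "\<dots> = ennreal (1 / l) * L_T k \<omega>"
    by (subst nn_integral_cmult) (auto simp: L_T_def \<omega>)
  also have "\<dots> = 1"
    using l by (simp add: L ennreal_mult[symmetric])
  finally show ?thesis .
qed

end

theory Submission imports Defs begin

text \<open>Integrating out the untruncated components shows that the half-space integral is finite at
  two kinds of parameters: those with positive definite \<open>\<Theta>\<close>, and degenerate ones, where no quadratic
  term in the truncated component remains but a linear one makes the remaining integrand decay
  exponentially. At a parameter of the second kind the truncated component is exponentially
  distributed. Such a parameter lies on the boundary, but the means of \<open>t\<close> and of \<open>t t'\<close> exist there;
  since the gradient of the cumulant function consists of such means, nothing forces it to blow up.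

  Concretely, let \<open>\<Theta>\<close> be diagonal with entry \<open>s\<close> at \<open>k\<close> and ones elsewhere, and let \<open>\<theta> = - axis k 1\<close>.
  This \<open>curve\<close> runs in the interior for \<open>0 < s \<le> 1\<close> and leaves the canonical parameter
  space for \<open>s < 0\<close>, hence meets the boundary at \<open>s = 0\<close> (\<open>boundary_curve_0\<close>). Along it, every
  directional derivative of \<open>K_T\<close> is the mean of a quadratic polynomial in \<open>t\<close> (\<open>deriv_K_T\<close>, by
  differentiation under the integral). On the half-space the unnormalized density is at most
  a constant times \<open>exp (- norm t)\<close>, with the same constant for all \<open>s \<ge> 0\<close>, and for \<open>0 < s \<le> 1\<close> the
  normalizing integral is smallest at \<open>s = 1\<close>; so the derivatives stay bounded as \<open>s\<close> decreases to \<open>0\<close>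
  (\<open>grad_bounded_on_curve\<close>), and the family is not steep at the limit point.\<close>

section \<open>Integrability of the dominating functions\<close>

lemma nn_integral_exp_abs_finite:
  fixes c :: real
  assumes "0 < c"
  shows "(\<integral>\<^sup>+x. ennreal (exp (- c * \<bar>x\<bar>)) \<partial>lborel) < \<infinity>"
proof -
  have "((\<lambda>x. - exp (- c * x) / c) \<longlongrightarrow> - 0 / c) at_top"
    using assms
    by (intro tendsto_divide tendsto_minus tendsto_const filterlim_compose[OF exp_at_bot]
        filterlim_tendsto_neg_mult_at_bot[OF tendsto_const] filterlim_ident) auto
  then have half: "(\<integral>\<^sup>+x. ennreal (exp (- c * x)) * indicator {0..} x \<partial>lborel) = ennreal (0 - (- 1 / c))"
    using assms
    by (subst nn_integral_FTC_atLeast[where F = "\<lambda>x. - exp (- c * x) / c" and T = 0])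
       (auto intro!: derivative_eq_intros)
  have "(\<integral>\<^sup>+x. ennreal (exp (- c * \<bar>x\<bar>)) \<partial>lborel) \<le>
      (\<integral>\<^sup>+x. ennreal (exp (- c * x)) * indicator {0..} x
          + ennreal (exp (- c * (- x))) * indicator {0..} (- x) \<partial>lborel)"
    by (intro nn_integral_mono) (auto simp: indicator_def)
  also have "\<dots> = (\<integral>\<^sup>+x. ennreal (exp (- c * x)) * indicator {0..} x \<partial>lborel)
      + (\<integral>\<^sup>+x. ennreal (exp (- c * (- x))) * indicator {0..} (- x) \<partial>lborel)"
    by (intro nn_integral_add) auto
  also have "(\<integral>\<^sup>+x. ennreal (exp (- c * (- x))) * indicator {0..} (- x) \<partial>lborel) =
      (\<integral>\<^sup>+x. ennreal (exp (- c * x)) * indicator {0..} x \<partial>lborel)"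
    by (subst (2) nn_integral_real_affine[where c = "-1" and t = 0]) auto
  finally show ?thesis
    unfolding half by (rule le_less_trans) simp
qed

text \<open>As \<open>norm t\<close> dominates each coordinate, it dominates their mean, so \<open>exp (- c * norm t)\<close> is
  bounded by a product of one-dimensional exponentials.\<close>

lemma integrable_exp_norm:
  fixes c :: real
  assumes "0 < c"
  shows "integrable lborel (\<lambda>t :: 'a::euclidean_space. exp (- c * norm t))"
proof (rule integrableI_bounded)
  define b where "b = c / DIM('a)"
  have b: "0 < b" using assms by (simp add: b_def)
  have le: "exp (- c * norm t) \<le> (\<Prod>i\<in>Basis. exp (- b * \<bar>t \<bullet> i\<bar>))" for t :: 'a
  proof -
    have "(\<Sum>i\<in>Basis. b * \<bar>t \<bullet> i\<bar>) \<le> (\<Sum>i\<in>(Basis :: 'a set). b * norm t)"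
      using b by (intro sum_mono mult_left_mono) (auto simp: Basis_le_norm)
    also have "\<dots> = c * norm t" by (simp add: b_def)
    finally show ?thesis by (simp add: exp_sum[symmetric] sum_negf)
  qed
  have "(\<integral>\<^sup>+t. ennreal (norm (exp (- c * norm t))) \<partial>(lborel :: 'a measure)) \<le>
      (\<integral>\<^sup>+t. (\<Prod>i\<in>Basis. ennreal (exp (- b * \<bar>t \<bullet> i\<bar>))) \<partial>(lborel :: 'a measure))"
    using le by (intro nn_integral_mono) (auto simp: prod_ennreal intro!: ennreal_leI)
  also have "\<dots> = (\<Prod>i\<in>(Basis :: 'a set). \<integral>\<^sup>+x. ennreal (exp (- b * \<bar>x\<bar>)) \<partial>lborel)"
    by (rule nn_integral_lborel_prod) auto
  also have "\<dots> < \<infinity>"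
    using nn_integral_exp_abs_finite[OF b]
    by (simp add: power_less_top_ennreal)
  finally show "(\<integral>\<^sup>+t. ennreal (norm (exp (- c * norm t))) \<partial>(lborel :: 'a measure)) < \<infinity>" .
qed auto

text \<open>Multiples of this function dominate the moment integrands and the difference quotients: the
  polynomial factor stands for the derivative of the exponent in the parameter, the exponential
  factor for the decay of the density.\<close>

definition envelope :: "'a::euclidean_space \<Rightarrow> real" where
  "envelope t = (1 + (norm t)\<^sup>2) * exp (- norm t)"

lemma envelope_nonneg [simp]: "0 \<le> envelope t"
  by (simp add: envelope_def)

lemma integrable_envelope: "integrable lborel envelope"
proof (rule Bochner_Integration.integrable_bound)
  show "integrable lborel (\<lambda>t :: 'a. 8 * exp (- (1 / 2) * norm t))"
    by (intro integrable_mult_right integrable_exp_norm) simp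
  show "(envelope :: 'a \<Rightarrow> real) \<in> borel_measurable lborel"
    unfolding envelope_def by measurable
  have "norm (envelope t) \<le> norm (8 * exp (- (1 / 2) * norm t))" for t :: 'a
  proof -
    have "1 + norm t / 2 + (norm t)\<^sup>2 / 8 \<le> exp (norm t / 2)"
      using exp_lower_Taylor_quadratic[of "norm t / 2"] by (simp add: power_divide)
    moreover have "0 \<le> norm t" by simp
    ultimately have "1 + (norm t)\<^sup>2 \<le> 8 * exp (norm t / 2)" by linarith
    then have "envelope t \<le> 8 * exp (norm t / 2) * exp (- norm t)"
      unfolding envelope_def by (intro mult_right_mono) auto
    also have "\<dots> = 8 * exp (- (1 / 2) * norm t)"
      by (simp add: exp_add[symmetric])
    finally show ?thesis by (simp add: envelope_def)
  qed
  then show "AE t :: 'a in lborel. norm (envelope t) \<le> norm (8 * exp (- (1 / 2) * norm t))"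
    by simp
qed

text \<open>Completing the square in the exponent gives the constant.\<close>

lemma exp_quadratic_le_exp_neg:
  fixes a c x :: real
  assumes "0 < c"
  shows "exp (a * x - c * x\<^sup>2) \<le> exp ((a + 1)\<^sup>2 / (4 * c)) * exp (- x)"
proof -
  have "0 \<le> c * (x - (a + 1) / (2 * c))\<^sup>2" using assms by simp
  also have "\<dots> = (a + 1)\<^sup>2 / (4 * c) - x - (a * x - c * x\<^sup>2)"
    using assms by (simp add: field_simps power2_eq_square)
  finally show ?thesis by (simp add: exp_add[symmetric])
qed


section \<open>The exponent and the normalizing integral\<close>

definition expo :: "'d::finite param \<Rightarrow> real ^ 'd \<Rightarrow> real" where
  "expo \<omega> t = fst \<omega> \<bullet> t - t \<bullet> (snd \<omega> *v t)"

lemma measurable_expo [measurable]: "expo \<omega> \<in> borel_measurable borel"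
  unfolding expo_def
  by (intro borel_measurable_continuous_onI continuous_intros
      linear_continuous_on matrix_vector_mul_bounded_linear)

text \<open>The exponent is linear in the parameter, so its derivative in the direction \<open>v\<close> is \<open>expo v\<close>.\<close>

lemma expo_line: "expo (\<omega> + h *\<^sub>R v) t = expo \<omega> t + h * expo v t"
  by (simp add: expo_def inner_add_left inner_add_right matrix_vector_mult_add_rdistrib
      scaleR_matrix_vector_assoc[symmetric] algebra_simps)

lemma norm_matrix_vector_le: "norm (A *v x) \<le> norm A * norm (x :: real ^ 'n::finite)"
proof -
  have "norm (A *v x) \<le> L2_set (\<lambda>i. norm (A $ i) * norm x) UNIV"
    unfolding norm_vec_def[of "A *v x"]
    by (intro L2_set_mono) (auto simp: matrix_vector_mul_component Cauchy_Schwarz_ineq2)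
  also have "\<dots> = norm A * norm x"
    by (simp add: L2_set_left_distrib norm_vec_def[of A])
  finally show ?thesis .
qed

lemma abs_quadratic_form_le: "\<bar>t \<bullet> (A *v t)\<bar> \<le> norm A * (norm (t :: real ^ 'n::finite))\<^sup>2"
proof -
  have "\<bar>t \<bullet> (A *v t)\<bar> \<le> norm t * (norm A * norm t)"
    by (rule order_trans[OF Cauchy_Schwarz_ineq2 mult_left_mono[OF norm_matrix_vector_le norm_ge_zero]])
  then show ?thesis by (simp add: power2_eq_square ac_simps)
qed

lemma add_square_le: "x + x\<^sup>2 \<le> 2 * (1 + (x :: real)\<^sup>2)"
proof -
  have "2 * (1 + x\<^sup>2) - (x + x\<^sup>2) = (x - 1 / 2)\<^sup>2 + 7 / 4"
    by (simp add: power2_eq_square field_simps)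
  also have "\<dots> \<ge> 0" by (intro add_nonneg_nonneg) auto
  finally show ?thesis by simp
qed

text \<open>The derivatives of the exponent in the parameter are polynomials of degree at most two in \<open>t\<close>,
  uniformly over directions of bounded norm.\<close>

lemma abs_expo_le: "\<bar>expo v t\<bar> \<le> 2 * norm v * (1 + (norm t)\<^sup>2)"
proof -
  have f: "norm (fst v) \<le> norm v" and s: "norm (snd v) \<le> norm v"
    using norm_fst_le[of "fst v" "snd v"] norm_snd_le[of "snd v" "fst v"] by simp_all
  have "\<bar>expo v t\<bar> \<le> norm (fst v) * norm t + norm (snd v) * (norm t)\<^sup>2"
    unfolding expo_def
    using Cauchy_Schwarz_ineq2[of "fst v" t] abs_quadratic_form_le[of t "snd v"] by linarith
  also have "\<dots> \<le> norm v * norm t + norm v * (norm t)\<^sup>2"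
    using f s by (intro add_mono mult_right_mono) auto
  also have "\<dots> = norm v * (norm t + (norm t)\<^sup>2)"
    by (simp only: distrib_left)
  also have "\<dots> \<le> norm v * (2 * (1 + (norm t)\<^sup>2))"
    by (rule mult_left_mono[OF add_square_le norm_ge_zero])
  also have "\<dots> = 2 * norm v * (1 + (norm t)\<^sup>2)"
    by (rule mult.left_commute[THEN trans, OF mult.assoc[symmetric]])
  finally show ?thesis .
qed

text \<open>A quantitative form of positive definiteness of the matrix component; the constant controls the
  Gaussian decay of the integrand.\<close>

definition coercive :: "'d::finite param \<Rightarrow> real \<Rightarrow> bool" where
  "coercive \<omega> c \<longleftrightarrow> (\<forall>t. c * (norm t)\<^sup>2 \<le> t \<bullet> (snd \<omega> *v t))"

lemma exp_expo_coercive_le: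
  assumes "coercive \<omega> c"
  shows "exp (expo \<omega> t) \<le> exp (norm (fst \<omega>) * norm t - c * (norm t)\<^sup>2)"
proof -
  have "fst \<omega> \<bullet> t \<le> norm (fst \<omega>) * norm t" by (rule norm_cauchy_schwarz)
  moreover have "c * (norm t)\<^sup>2 \<le> t \<bullet> (snd \<omega> *v t)"
    using assms by (simp add: coercive_def)
  ultimately show ?thesis unfolding exp_le_cancel_iff expo_def by linarith
qed

text \<open>Coercivity is an open condition: a perturbation \<open>v\<close> of the parameter changes the
  quadratic form by at most \<open>norm v * (norm t)\<^sup>2\<close>.\<close>

lemma coercive_add:
  assumes "coercive \<omega> c" "norm v \<le> e"
  shows "coercive (\<omega> + v) (c - e)"
  unfolding coercive_def
proof
  fix t :: "real ^ 'a"
  have "norm (snd v) \<le> e"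
    using norm_snd_le[of "snd v" "fst v"] assms(2) unfolding prod.collapse by linarith
  then have "norm (snd v) * (norm t)\<^sup>2 \<le> e * (norm t)\<^sup>2"
    by (rule mult_right_mono) simp
  moreover have "\<bar>t \<bullet> (snd v *v t)\<bar> \<le> norm (snd v) * (norm t)\<^sup>2"
    by (rule abs_quadratic_form_le)
  moreover have "c * (norm t)\<^sup>2 \<le> t \<bullet> (snd \<omega> *v t)"
    using assms(1) by (simp add: coercive_def)
  moreover have "t \<bullet> (snd (\<omega> + v) *v t) = t \<bullet> (snd \<omega> *v t) + t \<bullet> (snd v *v t)"
    by (simp add: matrix_vector_mult_add_rdistrib inner_add_right)
  moreover have "(c - e) * (norm t)\<^sup>2 = c * (norm t)\<^sup>2 - e * (norm t)\<^sup>2"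
    by (rule left_diff_distrib)
  ultimately show "(c - e) * (norm t)\<^sup>2 \<le> t \<bullet> (snd (\<omega> + v) *v t)" by linarith
qed

text \<open>The real-valued counterpart of \<open>L_T\<close>, to which the calculus of Bochner integrals applies.\<close>

definition partition_integral :: "'d::finite \<Rightarrow> 'd param \<Rightarrow> real" where
  "partition_integral k \<omega> = (\<integral>t. indicator (half_space k) t * exp (expo \<omega> t) \<partial>lborel)"

text \<open>The unnormalized mean of \<open>expo v\<close> under the density with parameter \<open>\<omega>\<close>; it is the derivative of
  the partition integral in the direction \<open>v\<close>.\<close>

definition moment_integral :: "'d::finite \<Rightarrow> 'd param \<Rightarrow> 'd param \<Rightarrow> real" where
  "moment_integral k \<omega> v =
     (\<integral>t. indicator (half_space k) t * (expo v t * exp (expo \<omega> t)) \<partial>lborel)"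

lemma integrable_coercive:
  assumes "coercive \<omega> c" "0 < c"
  shows "integrable lborel (\<lambda>t. indicator (half_space k) t * exp (expo \<omega> t))"
proof (rule Bochner_Integration.integrable_bound)
  let ?C = "exp ((norm (fst \<omega>) + 1)\<^sup>2 / (4 * c))"
  show "integrable lborel (\<lambda>t :: real ^ 'a. ?C * exp (- 1 * norm t))"
    by (intro integrable_mult_right integrable_exp_norm) simp
  have "exp (expo \<omega> t) \<le> ?C * exp (- 1 * norm t)" for t
    using exp_expo_coercive_le[OF assms(1), of t]
      exp_quadratic_le_exp_neg[OF assms(2), of "norm (fst \<omega>)" "norm t"]
    unfolding mult_minus1 by (rule order_trans)
  then show "AE t in lborel. norm (indicator (half_space k) t * exp (expo \<omega> t))
      \<le> norm (?C * exp (- 1 * norm t))"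
    by (auto simp: indicator_def)
qed measurable

lemma L_T_eq_nn_integral:
  "L_T k \<omega> = (\<integral>\<^sup>+t. ennreal (indicator (half_space k) t * exp (expo \<omega> t)) \<partial>lborel)"
  unfolding L_T_def case_prod_beta expo_def
  by (intro nn_integral_cong) (auto simp: indicator_def)

lemma K_T_eq_ln: "K_T k \<omega> = ln (partition_integral k \<omega>)"
  unfolding K_T_def L_T_eq_nn_integral partition_integral_def
  by (subst integral_eq_nn_integral) auto

lemma L_T_coercive_finite:
  assumes "coercive \<omega> c" "0 < c"
  shows "L_T k \<omega> < \<infinity>"
  using integrable_coercive[OF assms, of k]
  unfolding L_T_eq_nn_integral integrable_iff_bounded by (simp add: abs_mult)

lemma partition_integral_pos:
  assumes "coercive \<omega> c" "0 < c"
  shows "0 < partition_integral k \<omega>"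
proof -
  have "L_T k \<omega> = ennreal (partition_integral k \<omega>)"
    unfolding L_T_eq_nn_integral partition_integral_def
    by (rule nn_integral_eq_integral[OF integrable_coercive[OF assms]]) auto
  then show ?thesis
    using L_T_pos[of k "fst \<omega>" "snd \<omega>"] by simp
qed


section \<open>Differentiation under the integral\<close>

lemma abs_exp_minus_one_le: "\<bar>exp y - 1\<bar> \<le> \<bar>y\<bar> * exp \<bar>y :: real\<bar>"
proof (cases "0 \<le> y")
  case True
  have "1 - y \<le> exp (- y)" using exp_ge_add_one_self[of "- y"] by simp
  then have "exp y * (1 - y) \<le> exp y * exp (- y)" by (intro mult_left_mono) auto
  then show ?thesis using True by (simp add: exp_minus algebra_simps)
next
  case False
  then have "\<bar>exp y - 1\<bar> = 1 - exp y" by simp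
  also have "\<dots> \<le> \<bar>y\<bar> * 1" using exp_ge_add_one_self[of y] False by linarith
  also have "\<dots> \<le> \<bar>y\<bar> * exp \<bar>y\<bar>" by (intro mult_left_mono) auto
  finally show ?thesis .
qed

text \<open>Dominated convergence of the difference quotients. In absolute value, that of the integrand is at
  most \<open>\<bar>expo v t\<bar> * exp (\<bar>h\<bar> * \<bar>expo v t\<bar>)\<close> times the density; for small \<open>h\<close> the quadratic
  growth of \<open>\<bar>h\<bar> * \<bar>expo v t\<bar>\<close> is absorbed by the coercive quadratic form, which leaves a multiple of
  the envelope.\<close>

lemma has_derivative_partition_integral:
  assumes co: "coercive \<omega> c" and c: "0 < c"
  shows "((\<lambda>h. partition_integral k (\<omega> + h *\<^sub>R v)) has_field_derivative moment_integral k \<omega> v) (at 0)"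
proof -
  \<comment> \<open>The step is so small that the perturbation of the exponent uses up only half of the coercivity.\<close>
  define \<epsilon> where "\<epsilon> = c / (8 * (norm v + 1))"
  have pos: "0 < 8 * (norm v + 1)" by (simp add: add_nonneg_pos)
  then have \<epsilon>: "0 < \<epsilon>" using c by (simp add: \<epsilon>_def)
  have "\<epsilon> * (8 * (norm v + 1)) = c" using pos by (simp add: \<epsilon>_def)
  moreover have "\<epsilon> * (8 * (norm v + 1)) = 4 * (\<epsilon> * (2 * norm v)) + 8 * \<epsilon>"
    by (simp add: algebra_simps)
  moreover have "0 \<le> \<epsilon> * (2 * norm v)" using \<epsilon> by simp
  ultimately have \<epsilon>v: "\<epsilon> * (2 * norm v) \<le> c / 2"
    using \<epsilon> by linarith
  define C where "C = 2 * norm v * exp (c / 2) * exp ((norm (fst \<omega>) + 1)\<^sup>2 / (4 * (c / 2)))"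
  have bound: "norm (indicator (half_space k) t * (exp (expo \<omega> t) * ((exp (h * expo v t) - 1) / h)))
      \<le> C * envelope t" if h: "h \<in> ball 0 \<epsilon>" "h \<noteq> 0" for h t
  proof -
    let ?q = "1 + (norm t)\<^sup>2"
    have he: "\<bar>h\<bar> \<le> \<epsilon>" using h by simp
    have "\<bar>(exp (h * expo v t) - 1) / h\<bar> \<le> \<bar>h * expo v t\<bar> * exp \<bar>h * expo v t\<bar> / \<bar>h\<bar>"
      unfolding abs_divide by (intro divide_right_mono abs_exp_minus_one_le) auto
    also have "\<dots> = \<bar>expo v t\<bar> * exp (\<bar>h\<bar> * \<bar>expo v t\<bar>)"
      using h by (simp add: abs_mult)
    also have "\<dots> \<le> (2 * norm v * ?q) * exp (c / 2 * ?q)"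
    proof (intro mult_mono)
      show "\<bar>expo v t\<bar> \<le> 2 * norm v * ?q" by (rule abs_expo_le)
      have "\<bar>h\<bar> * \<bar>expo v t\<bar> \<le> \<epsilon> * (2 * norm v * ?q)"
        using he \<epsilon> by (intro mult_mono abs_expo_le) auto
      also have "\<dots> = \<epsilon> * (2 * norm v) * ?q" by simp
      also have "\<dots> \<le> c / 2 * ?q" using \<epsilon>v by (intro mult_right_mono) auto
      finally show "exp (\<bar>h\<bar> * \<bar>expo v t\<bar>) \<le> exp (c / 2 * ?q)" by simp
    qed auto
    finally have quot: "\<bar>(exp (h * expo v t) - 1) / h\<bar> \<le> (2 * norm v * ?q) * exp (c / 2 * ?q)" .
    have "norm (indicator (half_space k) t * (exp (expo \<omega> t) * ((exp (h * expo v t) - 1) / h)))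
        \<le> exp (expo \<omega> t) * \<bar>(exp (h * expo v t) - 1) / h\<bar>"
      by (auto simp: indicator_def abs_mult)
    also have "\<dots> \<le> exp (norm (fst \<omega>) * norm t - c * (norm t)\<^sup>2) * ((2 * norm v * ?q) * exp (c / 2 * ?q))"
      using quot exp_expo_coercive_le[OF co] by (intro mult_mono) auto
    also have "\<dots> = 2 * norm v * exp (c / 2) * ?q * exp (norm (fst \<omega>) * norm t - c / 2 * (norm t)\<^sup>2)"
    proof -
      have "exp (norm (fst \<omega>) * norm t - c * (norm t)\<^sup>2) * exp (c / 2 * ?q) =
          exp (c / 2) * exp (norm (fst \<omega>) * norm t - c / 2 * (norm t)\<^sup>2)"
        unfolding exp_add[symmetric] by (simp add: field_simps)
      from this[THEN arg_cong[where f = "\<lambda>x. 2 * norm v * ?q * x"]]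
      show ?thesis by (simp only: mult_ac)
    qed
    also have "\<dots> \<le> 2 * norm v * exp (c / 2) * ?q *
        (exp ((norm (fst \<omega>) + 1)\<^sup>2 / (4 * (c / 2))) * exp (- norm t))"
      using c by (intro mult_left_mono exp_quadratic_le_exp_neg) auto
    also have "\<dots> = C * envelope t" by (simp add: C_def envelope_def)
    finally show ?thesis .
  qed
  have coh: "coercive (\<omega> + h *\<^sub>R v) (c - c / 2)" if "h \<in> ball 0 \<epsilon>" for h
  proof (rule coercive_add[OF co])
    have "norm (h *\<^sub>R v) \<le> \<epsilon> * (2 * norm v)"
      using that \<epsilon> unfolding norm_scaleR by (intro mult_mono) auto
    then show "norm (h *\<^sub>R v) \<le> c / 2" using \<epsilon>v by linarith
  qed
  have quotient: "(partition_integral k (\<omega> + h *\<^sub>R v) - partition_integral k (\<omega> + 0 *\<^sub>R v)) / (h - 0) =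
      (\<integral>t. indicator (half_space k) t * (exp (expo \<omega> t) * ((exp (h * expo v t) - 1) / h)) \<partial>lborel)"
    if "h \<in> ball 0 \<epsilon>" for h
  proof -
    have "partition_integral k (\<omega> + h *\<^sub>R v) - partition_integral k \<omega> =
        (\<integral>t. indicator (half_space k) t * exp (expo (\<omega> + h *\<^sub>R v) t)
             - indicator (half_space k) t * exp (expo \<omega> t) \<partial>lborel)"
      unfolding partition_integral_def
      using integrable_coercive[OF coh[OF that]] integrable_coercive[OF co c] c
      by (intro Bochner_Integration.integral_diff[symmetric]) auto
    then have "(partition_integral k (\<omega> + h *\<^sub>R v) - partition_integral k (\<omega> + 0 *\<^sub>R v)) / (h - 0) =
        (\<integral>t. (indicator (half_space k) t * exp (expo (\<omega> + h *\<^sub>R v) t)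
             - indicator (half_space k) t * exp (expo \<omega> t)) / h \<partial>lborel)"
      by simp
    also have "\<dots> = (\<integral>t. indicator (half_space k) t * (exp (expo \<omega> t) * ((exp (h * expo v t) - 1) / h)) \<partial>lborel)"
      by (intro Bochner_Integration.integral_cong)
         (auto simp: expo_line exp_add indicator_def algebra_simps diff_divide_distrib)
    finally show ?thesis .
  qed
  have "((\<lambda>h. partition_integral k (\<omega> + h *\<^sub>R v)) has_field_derivative moment_integral k \<omega> v)
      (at 0 within ball 0 \<epsilon>)"
    unfolding has_field_derivative_iff tendsto_at_iff_sequentially
  proof (intro allI impI)
    fix X :: "nat \<Rightarrow> real"
    assume X: "\<forall>i. X i \<in> ball 0 \<epsilon> - {0}" and X0: "X \<longlonglongrightarrow> 0"
    have "(\<lambda>n. \<integral>t. indicator (half_space k) t * (exp (expo \<omega> t) * ((exp (X n * expo v t) - 1) / X n)) \<partial>lborel)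
        \<longlonglongrightarrow> (\<integral>t. indicator (half_space k) t * (expo v t * exp (expo \<omega> t)) \<partial>lborel)"
    proof (rule integral_dominated_convergence)
      show "integrable lborel (\<lambda>t :: real ^ 'a. C * envelope t)"
        by (intro integrable_mult_right integrable_envelope)
      show "AE t in lborel. norm (indicator (half_space k) t *
          (exp (expo \<omega> t) * ((exp (X n * expo v t) - 1) / X n))) \<le> C * envelope t" for n
        using bound X by auto
      have "(\<lambda>n. (exp (X n * expo v t) - 1) / X n) \<longlonglongrightarrow> expo v t" for t
      proof -
        have "((\<lambda>h. exp (h * expo v t)) has_field_derivative expo v t) (at 0)"
          by (auto intro!: derivative_eq_intros)
        then have "((\<lambda>h. (exp (h * expo v t) - 1) / h) \<longlongrightarrow> expo v t) (at 0)"
          unfolding has_field_derivative_iff by simp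
        then show ?thesis
          using X X0 by (auto simp: tendsto_at_iff_sequentially o_def)
      qed
      then have "(\<lambda>n. indicator (half_space k) t *
          (exp (expo \<omega> t) * ((exp (X n * expo v t) - 1) / X n))) \<longlonglongrightarrow>
          indicator (half_space k) t * (exp (expo \<omega> t) * expo v t)" for t
        by (intro tendsto_mult_left)
      then show "AE t in lborel. (\<lambda>n. indicator (half_space k) t *
          (exp (expo \<omega> t) * ((exp (X n * expo v t) - 1) / X n))) \<longlonglongrightarrow>
          indicator (half_space k) t * (expo v t * exp (expo \<omega> t))"
        by (intro AE_I2) (simp only: mult.commute[of "expo v _"])
    qed measurable
    moreover have "(partition_integral k (\<omega> + X n *\<^sub>R v) - partition_integral k (\<omega> + 0 *\<^sub>R v)) / (X n - 0) =
        (\<integral>t. indicator (half_space k) t * (exp (expo \<omega> t) * ((exp (X n * expo v t) - 1) / X n)) \<partial>lborel)" for n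
      using X by (intro quotient) auto
    ultimately show "((\<lambda>h. (partition_integral k (\<omega> + h *\<^sub>R v) - partition_integral k (\<omega> + 0 *\<^sub>R v)) / (h - 0)) \<circ> X)
        \<longlonglongrightarrow> moment_integral k \<omega> v"
      by (simp only: o_def moment_integral_def)
  qed
  then show ?thesis
    using \<epsilon> by (simp add: at_within_open[where S = "ball 0 \<epsilon>"])
qed

lemma deriv_K_T:
  assumes "coercive \<omega> c" "0 < c"
  shows "deriv (\<lambda>h. K_T k (\<omega> + h *\<^sub>R v)) 0 = moment_integral k \<omega> v / partition_integral k \<omega>"
proof (rule DERIV_imp_deriv)
  have "((\<lambda>h. ln (partition_integral k (\<omega> + h *\<^sub>R v))) has_field_derivative
      1 / partition_integral k (\<omega> + 0 *\<^sub>R v) * moment_integral k \<omega> v) (at 0)"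
    using partition_integral_pos[OF assms, of k]
    by (intro DERIV_chain2[OF DERIV_ln_divide has_derivative_partition_integral[OF assms]]) simp
  then show "((\<lambda>h. K_T k (\<omega> + h *\<^sub>R v)) has_field_derivative
      moment_integral k \<omega> v / partition_integral k \<omega>) (at 0)"
    by (simp add: K_T_eq_ln)
qed

text \<open>The entries of the gradient are derivatives in finitely many fixed directions, possibly halved,
  so a bound for the directional derivatives that is linear in the direction bounds its norm.\<close>

lemma norm_grad_le:
  fixes K :: "'d::finite param \<Rightarrow> real"
  assumes "\<And>v. \<bar>deriv (\<lambda>h. K (\<omega> + h *\<^sub>R v)) 0\<bar> \<le> C * norm v"
  shows "norm (grad K \<omega>) \<le>
    (\<Sum>i\<in>UNIV. C * norm (axis i 1 :: real ^ 'd)) + (\<Sum>i\<in>UNIV. \<Sum>j\<in>UNIV. C * norm (sym_unit i j :: real ^ 'd ^ 'd))"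
proof -
  have t: "\<bar>partial_theta K \<omega> i\<bar> \<le> C * norm (axis i 1 :: real ^ 'd)" for i
    using assms[of "(axis i 1, 0)"] by (simp add: partial_theta_def plus_prod_def norm_Pair)
  have T: "\<bar>partial_Theta K \<omega> i j\<bar> \<le> C * norm (sym_unit i j :: real ^ 'd ^ 'd)" for i j
    using assms[of "(0, sym_unit i j)"] by (simp add: partial_Theta_def plus_prod_def norm_Pair)
  have T': "\<bar>1/2 * (1 + (if i = j then 1 else 0)) * partial_Theta K \<omega> i j\<bar> \<le> C * norm (sym_unit i j :: real ^ 'd ^ 'd)" for i j
    using T[of i j] by (auto simp: abs_mult)
  show ?thesis
    unfolding grad_def
  proof (rule order_trans[OF norm_Pair_le], rule add_mono)
    show "norm (\<chi> i. partial_theta K \<omega> i) \<le> (\<Sum>i\<in>UNIV. C * norm (axis i 1 :: real ^ 'd))"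
      by (rule order_trans[OF norm_le_l1_cart]) (simp only: vec_lambda_beta, intro sum_mono t)
    let ?M = "(\<chi> i j. 1/2 * (1 + (if i = j then 1 else 0)) * partial_Theta K \<omega> i j) :: real ^ 'd ^ 'd"
    have "norm ?M \<le> (\<Sum>i\<in>UNIV. norm (?M $ i))"
      unfolding norm_vec_def[of ?M] by (rule L2_set_le_sum) auto
    also have "\<dots> \<le> (\<Sum>i\<in>UNIV. \<Sum>j\<in>UNIV. \<bar>?M $ i $ j\<bar>)"
      by (intro sum_mono norm_le_l1_cart)
    also have "\<dots> \<le> (\<Sum>i\<in>UNIV. \<Sum>j\<in>UNIV. C * norm (sym_unit i j :: real ^ 'd ^ 'd))"
      by (intro sum_mono) (use T' in simp)
    finally show "norm ?M \<le> (\<Sum>i\<in>UNIV. \<Sum>j\<in>UNIV. C * norm (sym_unit i j :: real ^ 'd ^ 'd))" .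
  qed
qed


section \<open>A curve in the parameter space that reaches its boundary\<close>

text \<open>The linear part \<open>- axis k 1\<close> keeps the integrand decaying along the truncated direction when the
  quadratic part there, of strength \<open>s\<close>, vanishes.\<close>

definition curve :: "'d::finite \<Rightarrow> real \<Rightarrow> 'd param" where
  "curve k s = (- axis k 1, \<chi> i j. if i = j then (if i = k then s else 1) else 0)"

lemma quadratic_form_curve:
  "t \<bullet> (snd (curve k s) *v t) = (\<Sum>i\<in>UNIV. (if i = k then s else 1) * (t $ i)\<^sup>2)"
proof -
  have "(snd (curve k s) *v t) $ i = (if i = k then s else 1) * t $ i" for i
    by (simp add: curve_def matrix_vector_mult_def if_distrib[of "\<lambda>x. x * _"] cong: if_cong)
  then show ?thesis by (simp add: inner_vec_def power2_eq_square ac_simps)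
qed

lemma expo_curve:
  "expo (curve k s) t = - t $ k - (\<Sum>i\<in>UNIV. (if i = k then s else 1) * (t $ i)\<^sup>2)"
  unfolding expo_def quadratic_form_curve
  by (simp add: curve_def inner_axis' )

lemma curve_sym: "snd (curve k s) \<in> sym_matrices"
  by (auto simp: sym_matrices_def curve_def transpose_def vec_eq_iff)

lemma coercive_curve:
  assumes "s \<le> 1"
  shows "coercive (curve k s) s"
  unfolding coercive_def quadratic_form_curve
proof
  fix t :: "real ^ 'a"
  have "s * (norm t)\<^sup>2 = (\<Sum>i\<in>UNIV. s * (t $ i)\<^sup>2)"
    by (simp add: norm_vec_def L2_set_def sum_nonneg sum_distrib_left)
  also have "\<dots> \<le> (\<Sum>i\<in>UNIV. (if i = k then s else 1) * (t $ i)\<^sup>2)"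
    using assms by (intro sum_mono mult_right_mono) auto
  finally show "s * (norm t)\<^sup>2 \<le> (\<Sum>i\<in>UNIV. (if i = k then s else 1) * (t $ i)\<^sup>2)" .
qed

text \<open>The uniform bound that makes the moments converge up to the boundary. On the half-space
  \<open>t $ k = \<bar>t $ k\<bar>\<close>, and every other square satisfies \<open>(t $ i)\<^sup>2 \<ge> \<bar>t $ i\<bar> - 1 / 4\<close>, so the exponent is at
  most a constant minus the sum of all \<open>\<bar>t $ i\<bar>\<close>.\<close>

lemma exp_expo_curve_le:
  fixes k :: "'d::finite"
  assumes "0 \<le> s" "t \<in> half_space k"
  shows "exp (expo (curve k s) t) \<le> exp (CARD('d) / 4) * exp (- norm t)"
proof -
  have "norm t \<le> (\<Sum>i\<in>UNIV. \<bar>t $ i\<bar>)" by (rule norm_le_l1_cart)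
  also have "\<dots> \<le> (\<Sum>i\<in>UNIV. 1 / 4 + (if i = k then t $ k else 0) + (if i = k then s else 1) * (t $ i)\<^sup>2)"
  proof (intro sum_mono)
    fix i :: 'd
    have "0 \<le> (\<bar>t $ i\<bar> - 1 / 2)\<^sup>2" by simp
    then have "\<bar>t $ i\<bar> \<le> 1 / 4 + (t $ i)\<^sup>2" by (simp add: power2_diff power_divide)
    then show "\<bar>t $ i\<bar> \<le> 1 / 4 + (if i = k then t $ k else 0) + (if i = k then s else 1) * (t $ i)\<^sup>2"
      using assms by (auto simp: half_space_def add_increasing2)
  qed
  also have "\<dots> = CARD('d) / 4 - expo (curve k s) t"
    by (simp add: sum.distrib expo_curve)
  finally show ?thesis by (simp add: exp_add[symmetric])
qed

lemma moment_integral_curve_le: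
  fixes k :: "'d::finite"
  assumes "0 \<le> s"
  shows "\<bar>moment_integral k (curve k s) v\<bar> \<le>
    2 * norm v * exp (CARD('d) / 4) * (\<integral>t. envelope (t :: real ^ 'd) \<partial>lborel)"
proof -
  let ?B = "2 * norm v * exp (CARD('d) / 4)"
  have "\<bar>moment_integral k (curve k s) v\<bar> \<le>
      (\<integral>t. norm (indicator (half_space k) t * (expo v t * exp (expo (curve k s) t))) \<partial>lborel)"
    unfolding moment_integral_def real_norm_def[symmetric] by (rule integral_norm_bound)
  also have "\<dots> \<le> (\<integral>t. ?B * envelope (t :: real ^ 'd) \<partial>lborel)"
  proof (rule integral_mono_AE')
    show "integrable lborel (\<lambda>t :: real ^ 'd. ?B * envelope t)"
      by (intro integrable_mult_right integrable_envelope)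
    have "norm (indicator (half_space k) t * (expo v t * exp (expo (curve k s) t))) \<le> ?B * envelope t" for t
    proof (cases "t \<in> half_space k")
      case True
      have "\<bar>expo v t\<bar> * exp (expo (curve k s) t) \<le>
          (2 * norm v * (1 + (norm t)\<^sup>2)) * (exp (CARD('d) / 4) * exp (- norm t))"
        using exp_expo_curve_le[OF assms True] by (intro mult_mono abs_expo_le) auto
      then show ?thesis using True by (simp add: envelope_def abs_mult algebra_simps)
    qed (simp add: envelope_def)
    then show "AE t in lborel. norm (indicator (half_space k) t * (expo v t * exp (expo (curve k s) t))) \<le> ?B * envelope t"
      by simp
  qed simp
  finally show ?thesis by simp
qed

lemma partition_integral_curve_antimono:
  assumes "0 < s" "s \<le> 1"
  shows "partition_integral k (curve k 1) \<le> partition_integral k (curve k s)"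
  unfolding partition_integral_def
proof (rule integral_mono)
  show "integrable lborel (\<lambda>t. indicator (half_space k) t * exp (expo (curve k 1) t))"
    by (rule integrable_coercive[OF coercive_curve]) auto
  show "integrable lborel (\<lambda>t. indicator (half_space k) t * exp (expo (curve k s) t))"
    by (rule integrable_coercive[OF coercive_curve]) (use assms in auto)
  have "expo (curve k 1) t \<le> expo (curve k s) t" for t
    unfolding expo_curve using assms by (intro diff_left_mono sum_mono mult_right_mono) auto
  then show "indicator (half_space k) t * exp (expo (curve k 1) t)
      \<le> indicator (half_space k) t * exp (expo (curve k s) t)" for t
    by (auto simp: indicator_def)
qed

lemma grad_bounded_on_curve:
  fixes k :: "'d::finite"
  obtains B where "\<And>s. 0 < s \<Longrightarrow> s \<le> 1 \<Longrightarrow> norm (grad (K_T k) (curve k s)) \<le> B"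
proof -
  define m where "m = partition_integral k (curve k 1)"
  have m: "0 < m" unfolding m_def by (rule partition_integral_pos[OF coercive_curve]) auto
  define C where "C = 2 * exp (CARD('d) / 4) * (\<integral>t. envelope (t :: real ^ 'd) \<partial>lborel) / m"
  have "\<bar>deriv (\<lambda>h. K_T k (curve k s + h *\<^sub>R v)) 0\<bar> \<le> C * norm v" if s: "0 < s" "s \<le> 1" for s v
  proof -
    have "\<bar>deriv (\<lambda>h. K_T k (curve k s + h *\<^sub>R v)) 0\<bar> =
        \<bar>moment_integral k (curve k s) v\<bar> / partition_integral k (curve k s)"
      using partition_integral_pos[OF coercive_curve[OF s(2), of k] s(1), of k]
      by (simp add: deriv_K_T[OF coercive_curve[OF s(2)] s(1)])
    also have "\<dots> \<le> (2 * norm v * exp (CARD('d) / 4) * (\<integral>t. envelope (t :: real ^ 'd) \<partial>lborel)) / m"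
      using moment_integral_curve_le[of s k v] partition_integral_curve_antimono[OF s, of k] m s
      unfolding m_def by (intro frac_le) simp_all
    also have "\<dots> = C * norm v" by (simp add: C_def)
    finally show ?thesis .
  qed
  then show ?thesis using that norm_grad_le by blast
qed

lemma curve_interior:
  assumes "0 < s" "s \<le> 1"
  shows "curve k s \<in> par_interior (canonical_space k)"
  unfolding par_interior_def interior_of_def param_topology_def
proof (intro CollectI exI conjI)
  let ?T = "UNIV \<times> sym_matrices \<inter> ball (curve k s) (s / 2)"
  show "openin (top_of_set (UNIV \<times> sym_matrices)) ?T"
    by (rule openin_open_Int) simp
  show "curve k s \<in> ?T" using assms curve_sym[of k s] by (auto simp: mem_Times_iff)
  show "?T \<subseteq> canonical_space k"
  proof
    fix \<omega> assume w: "\<omega> \<in> ?T"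
    have "norm (\<omega> - curve k s) \<le> s / 2" using w by (simp add: dist_norm norm_minus_commute)
    from coercive_add[OF coercive_curve[OF assms(2), of k] this]
    have "coercive \<omega> (s / 2)" by simp
    then show "\<omega> \<in> canonical_space k"
      using L_T_coercive_finite[of \<omega> "s / 2" k] assms w by (auto simp: canonical_space_def)
  qed
qed

text \<open>For negative \<open>s\<close> and \<open>t $ k \<ge> - 1 / s\<close> the two terms of the exponent in \<open>t $ k\<close> add up to a
  nonnegative number. So the integrand is bounded below on boxes that are arbitrarily long in the
  truncated direction and have side one in the others.\<close>

lemma L_T_curve_infinite:
  fixes k :: "'d::finite"
  assumes "s < 0"
  shows "L_T k (curve k s) = \<infinity>"
proof (rule ccontr)
  define l where "l = enn2real (L_T k (curve k s))"
  assume "L_T k (curve k s) \<noteq> \<infinity>"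
  then have L: "L_T k (curve k s) = ennreal l" by (simp add: l_def less_top)
  define e where "e = exp (- real CARD('d))"
  have e: "0 < e" by (simp add: e_def)
  \<comment> \<open>The length of the box, chosen so that the lower bound \<open>e * n\<close> exceeds \<open>l\<close>.\<close>
  define n where "n = l / e + 1"
  have l0: "0 \<le> l" by (simp add: l_def)
  then have n: "0 < n" using e by (simp add: n_def add_nonneg_pos)
  define x where "x = (- 1 / s)"
  have x: "0 < x" using assms by (simp add: x_def divide_neg_neg)
  define a :: "real ^ 'd" where "a = (\<chi> i. if i = k then x else 0)"
  define b :: "real ^ 'd" where "b = (\<chi> i. if i = k then x + n else 1)"
  have ne: "cbox a b \<noteq> {}" using n by (auto simp: interval_ne_empty_cart a_def b_def)
  have "measure lborel (cbox a b) = (\<Prod>i\<in>UNIV. if i = k then n else 1)"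
    unfolding content_cbox_cart[OF ne] by (rule prod.cong) (auto simp: a_def b_def)
  then have vol: "emeasure lborel (cbox a b) = ennreal n"
    using emeasure_eq_ennreal_measure[of lborel "cbox a b"] emeasure_lborel_cbox_finite[of a b] by simp
  have ge: "e * indicator (cbox a b) t \<le> indicator (half_space k) t * exp (expo (curve k s) t)" for t
  proof (cases "t \<in> cbox a b")
    case True
    then have ti: "\<And>i. a $ i \<le> t $ i" "\<And>i. t $ i \<le> b $ i" by (auto simp: mem_box_cart)
    have tk: "x \<le> t $ k" using ti(1)[of k] by (simp add: a_def)
    have k0: "t \<in> half_space k" using tk x by (simp add: half_space_def)
    have tk': "t $ k + s * (t $ k)\<^sup>2 \<le> 0"
    proof -
      have "1 + s * t $ k \<le> 0" using tk assms by (simp add: x_def field_simps)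
      then have "t $ k * (1 + s * t $ k) \<le> 0" using tk x by (intro mult_nonneg_nonpos) auto
      then show ?thesis by (simp add: algebra_simps power2_eq_square)
    qed
    have "(\<Sum>i\<in>UNIV. (if i = k then t $ k else 0) + (if i = k then s else 1) * (t $ i)\<^sup>2) \<le> (\<Sum>i\<in>(UNIV :: 'd set). 1)"
    proof (intro sum_mono)
      fix i :: 'd
      show "(if i = k then t $ k else 0) + (if i = k then s else 1) * (t $ i)\<^sup>2 \<le> 1"
      proof (cases "i = k")
        case False
        then have "0 \<le> t $ i" "t $ i \<le> 1" using ti[of i] by (auto simp: a_def b_def)
        then show ?thesis using False by (simp add: power_le_one)
      qed (use tk' in simp)
    qed
    then have "- real CARD('d) \<le> expo (curve k s) t"
      by (simp add: expo_curve sum.distrib)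
    then show ?thesis using True k0 by (simp add: e_def)
  qed (simp add: indicator_def)
  have "ennreal (e * n) = (\<integral>\<^sup>+t. ennreal e * indicator (cbox a b) t \<partial>lborel)"
    using e n by (simp add: nn_integral_cmult_indicator vol ennreal_mult)
  also have "\<dots> \<le> L_T k (curve k s)"
    unfolding L_T_eq_nn_integral
  proof (intro nn_integral_mono)
    fix t
    have "ennreal e * indicator (cbox a b) t = ennreal (e * indicator (cbox a b) t)"
      by (simp add: indicator_def)
    then show "ennreal e * indicator (cbox a b) t \<le> ennreal (indicator (half_space k) t * exp (expo (curve k s) t))"
      using ge[of t] by (simp add: ennreal_leI)
  qed
  finally have "e * n \<le> l" using L l0 by simp
  moreover have "e * n = l + e" using e by (simp add: n_def field_simps)
  ultimately show False using e by simp
qed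

lemma continuous_curve: "continuous_on UNIV (curve k)"
  unfolding curve_def
proof (intro continuous_on_Pair continuous_on_const continuous_on_vec_lambda)
  show "continuous_on UNIV (\<lambda>s. if i = j then if i = k then s else 1 else (0 :: real))" for i j
    by (cases "i = j"; cases "i = k") simp_all
qed

lemma curve_tendsto: "(curve k \<longlongrightarrow> curve k 0) (at 0 within S)"
  using continuous_curve[of k]
  by (metis UNIV_I continuous_on continuous_on_subset subset_UNIV tendsto_within_subset)

lemma not_interior_curve_0: "curve k 0 \<notin> par_interior (canonical_space k)"
proof
  assume "curve k 0 \<in> par_interior (canonical_space k)"
  then obtain U where U: "open U" "curve k 0 \<in> U" "UNIV \<times> sym_matrices \<inter> U \<subseteq> canonical_space k"
    unfolding par_interior_def interior_of_def param_topology_def openin_open by auto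
  have "eventually (\<lambda>s. curve k s \<in> U) (at_left 0)"
    using curve_tendsto U(1,2) by (rule topological_tendstoD)
  moreover have "eventually (\<lambda>s. s < 0) (at_left (0 :: real))"
    by (simp add: eventually_at_filter)
  ultimately have "eventually (\<lambda>s :: real. False) (at_left 0)"
  proof eventually_elim
    case (elim s)
    have "curve k s \<in> canonical_space k"
      using elim(1) U(3) curve_sym[of k s] by (auto simp: mem_Times_iff)
    then show False using L_T_curve_infinite[OF elim(2), of k] by (simp add: canonical_space_def)
  qed
  then show False by simp
qed

lemma eventually_curve_interior:
  "eventually (\<lambda>s. curve k s \<in> par_interior (canonical_space k)) (at_right 0)"
  unfolding eventually_at_right_field
  by (rule exI[of _ 1]) (auto intro: curve_interior)

lemma boundary_curve_0: "curve k 0 \<in> par_boundary (par_interior (canonical_space k))"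
proof -
  let ?I = "par_interior (canonical_space k)"
  have top: "curve k 0 \<in> topspace param_topology"
    using curve_sym[of k 0] by (simp add: param_topology_def mem_Times_iff)
  have "curve k 0 \<in> param_topology closure_of ?I"
    unfolding in_closure_of
  proof (intro conjI top allI impI)
    fix T assume T: "curve k 0 \<in> T \<and> openin param_topology T"
    then obtain U where U: "open U" "T = UNIV \<times> sym_matrices \<inter> U"
      by (auto simp: param_topology_def openin_open)
    have "eventually (\<lambda>s. curve k s \<in> U) (at_right 0)"
      using curve_tendsto U T by (intro topological_tendstoD) auto
    with eventually_curve_interior[of k]
    have "eventually (\<lambda>s. curve k s \<in> ?I \<and> curve k s \<in> T) (at_right 0)"
      by eventually_elim (use U(2) curve_sym[of k] in \<open>auto simp: mem_Times_iff\<close>)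
    then show "\<exists>y. y \<in> ?I \<and> y \<in> T"
      using eventually_happens'[OF trivial_limit_at_right_real] by blast
  qed
  moreover have "curve k 0 \<in> param_topology closure_of (topspace param_topology - ?I)"
    using top not_interior_curve_0[of k]
    by (intro subsetD[OF closure_of_subset]) auto
  ultimately show ?thesis by (simp add: par_boundary_def)
qed


section \<open>Failure of steepness\<close>

theorem theorem5p2:
  fixes k :: "'d::finite"
  assumes "CARD('d) \<ge> 2"
  shows "\<not> steep (canonical_space k) (K_T k)"
proof
  assume "steep (canonical_space k) (K_T k)"
  then have "filterlim (\<lambda>\<omega>. norm (grad (K_T k) \<omega>)) at_top
      (at (curve k 0) within par_interior (canonical_space k))"
    using boundary_curve_0 by (auto simp: steep_def steep_at_def)
  moreover have "filterlim (curve k) (at (curve k 0) within par_interior (canonical_space k)) (at_right 0)"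
    unfolding filterlim_at
  proof (intro conjI curve_tendsto)
    show "\<forall>\<^sub>F s in at_right 0. curve k s \<in> par_interior (canonical_space k) \<and> curve k s \<noteq> curve k 0"
      using eventually_curve_interior[of k] by eventually_elim (use not_interior_curve_0[of k] in auto)
  qed
  ultimately have lim: "filterlim (\<lambda>s. norm (grad (K_T k) (curve k s))) at_top (at_right 0)"
    by (rule filterlim_compose)
  obtain B where B: "\<And>s. 0 < s \<Longrightarrow> s \<le> 1 \<Longrightarrow> norm (grad (K_T k) (curve k s)) \<le> B"
    using grad_bounded_on_curve[of k] by blast
  have "eventually (\<lambda>s. B < norm (grad (K_T k) (curve k s))) (at_right 0)"
    using lim by (simp add: filterlim_at_top_dense)
  moreover have "eventually (\<lambda>s :: real. 0 < s \<and> s \<le> 1) (at_right 0)"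
    unfolding eventually_at_right_field by (rule exI[of _ 1]) auto
  ultimately have "eventually (\<lambda>s :: real. False) (at_right 0)"
    by eventually_elim (use B in force)
  then show False by simp
qed

end
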